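(* Let $m$ be a primitive weird number and let $\Omega(m)$ denote the number of prime factors of $m$ counted with multiplicity. (i) If $\Omega(m)<7$, then there is no odd prime $q$ with $q^2 \mid m$. (ii) If $\Omega(m)=7$, then $m$ does not have two distinct odd prime factors $q_1,q_2$ with $q_1^2\,\|\,m$ and $q_2^2\,\|\,m$. (iii) If $\Omega(m)=7$, then there is no odd prime $q$ with $q^3\mid m$.
   Context: For $n\in\mathbb{N}$, $\sigma(n)=\sum_{d\mid n}d$. A number $n$ is abundant if $\sigma(n)>2n$. It is semiperfect if it is abundant and can be written as a sum of distinct proper divisors of $n$. It is weird if it is abundant but not semiperfect. A primitive weird number is a weird number that is not a multiple of any smaller weird number. $q^\alpha\,\|\,m$ means $q^\alpha\mid m$ and $q^{\alpha+1}\nmid m$. *)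

theory Defs
  imports "HOL-Computational_Algebra.Computational_Algebra"
begin

definition sigma :: "nat \<Rightarrow> nat" where
  "sigma n = (\<Sum>d | d dvd n. d)"

text \<open>
  Zero has infinitely many divisors, so \<open>sigma 0 = 0\<close> by the convention for infinite sums;
  hence \<open>0\<close> is not abundant, and none of the notions below applies to it.
\<close>

definition abundant :: "nat \<Rightarrow> bool" where
  "abundant n \<longleftrightarrow> sigma n > 2 * n"

text \<open>
  Semiperfect numbers are abundant by definition here, so perfect numbers are excluded.
\<close>

definition semiperfect :: "nat \<Rightarrow> bool" where
  "semiperfect n \<longleftrightarrow> abundant n \<and> (\<exists>S \<subseteq> {d. d dvd n \<and> d \<noteq> n}. n = \<Sum>S)"

definition weird :: "nat \<Rightarrow> bool" where
  "weird n \<longleftrightarrow> abundant n \<and> \<not> semiperfect n"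

definition primitive_weird :: "nat \<Rightarrow> bool" where
  "primitive_weird m \<longleftrightarrow> weird m \<and> \<not> (\<exists>k < m. weird k \<and> k dvd m)"

definition bigomega :: "nat \<Rightarrow> nat" where
  "bigomega n = size (prime_factorization n)"

definition exactly_divides :: "nat \<Rightarrow> nat \<Rightarrow> nat \<Rightarrow> bool" where
  "exactly_divides q \<alpha> m \<longleftrightarrow> q ^ \<alpha> dvd m \<and> \<not> q ^ (\<alpha> + 1) dvd m"

end

theory Submission
  imports Defs "HOL-Library.Code_Binary_Nat"
begin

text \<open>
  Every proper divisor of a primitive weird number \<open>m\<close> is deficient, and \<open>\<sigma>(m) - 2m\<close> is not a sum of
  distinct divisors of \<open>m\<close> other than \<open>m\<close>. Write \<open>m = 2\<^sup>a r\<close> with \<open>r\<close> odd. In each of the three cases,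
  \<open>\<Omega>(m) \<le> 7\<close>, \<open>a + \<omega>(r) \<le> 5\<close> and \<open>r\<close> is not squarefree. Since prefixes of the factorization are deficient
  while \<open>m\<close> is abundant, only about a thousand prefixes survive the estimate
  \<open>\<sigma>(r)/r \<le> (q/(q-1))\<^bsup>\<omega>(r)\<^esup>\<close>, where \<open>q\<close> is the least prime factor of \<open>r\<close>. If \<open>n\<close> is all of \<open>m\<close> but its largest
  prime \<open>p\<close>, then \<open>\<sigma>(m) - 2m = \<sigma>(n) - p(2n - \<sigma>(n))\<close>, and nearly all of these values, for all
  admissible \<open>p\<close> at once, lie in a few intervals consisting of sums of distinct divisors of \<open>n\<close>. The other
  values are checked one by one.
\<close>

section \<open>Divisor sums and primitive weird numbers\<close>

lemma sigma_0: "sigma 0 = 0"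
  by (simp add: sigma_def)

text \<open>A divisor of \<open>n * q ^ Suc e\<close> prime to \<open>q\<close> divides
  \<open>n\<close>; every other one is \<open>q\<close> times a divisor of \<open>n * q ^ e\<close>.
  The search updates divisor sums and divisor lists by this recursion.\<close>

lemma sigma_extend:
  assumes "prime q" "\<not> q dvd n" "0 < n"
  shows "sigma (n * q ^ Suc e) = sigma n + q * sigma (n * q ^ e)"
proof -
  have q0: "q > 0" using assms(1) prime_gt_0_nat by blast
  have pos: "n * q ^ e > 0" using assms(3) q0 by simp
  have eq: "{d. d dvd n * q ^ Suc e} = {d. d dvd n} \<union> (*) q ` {d. d dvd n * q ^ e}"
  proof (intro set_eqI iffI)
    fix d assume "d \<in> {d. d dvd n * q ^ Suc e}"
    hence d: "d dvd n * q ^ Suc e" by simp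
    show "d \<in> {d. d dvd n} \<union> (*) q ` {d. d dvd n * q ^ e}"
    proof (cases "q dvd d")
      case True
      then obtain c where c: "d = q * c" by blast
      with d have "q * c dvd q * (n * q ^ e)" by (simp add: mult_ac)
      hence "c dvd n * q ^ e" using q0 by simp
      thus ?thesis using c by blast
    next
      case False
      hence "coprime d (q ^ Suc e)" using assms(1) by (metis coprime_commute coprime_power_right_iff prime_imp_coprime)
      thus ?thesis using d coprime_dvd_mult_left_iff by blast
    qed
  next
    fix d assume "d \<in> {d. d dvd n} \<union> (*) q ` {d. d dvd n * q ^ e}"
    thus "d \<in> {d. d dvd n * q ^ Suc e}" by (auto simp: mult.left_commute intro: mult_dvd_mono)
  qed
  have disj: "{d. d dvd n} \<inter> (*) q ` {d. d dvd n * q ^ e} = {}"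
    using assms(2) dvd_mult_left by auto
  have "sigma (n * q ^ Suc e) = sigma n + \<Sum>((*) q ` {d. d dvd n * q ^ e})"
    unfolding sigma_def eq
    by (rule sum.union_disjoint) (use disj assms(3) pos in auto)
  also have "\<Sum>((*) q ` {d. d dvd n * q ^ e}) = (\<Sum>d | d dvd n * q ^ e. q * d)"
    by (rule sum.reindex_cong[of "(*) q"]) (use q0 in \<open>auto simp: inj_on_def\<close>)
  also have "\<dots> = q * sigma (n * q ^ e)"
    unfolding sigma_def by (simp add: sum_distrib_left)
  finally show ?thesis .
qed

lemma sigma_prime_power_mult:
  assumes "prime q" "\<not> q dvd n" "0 < n"
  shows "sigma (n * q ^ e) * (q - 1) = sigma n * (q ^ Suc e - 1)"
proof -
  obtain c where c: "q = Suc c" using prime_gt_0_nat[OF assms(1)] by (metis gr0_conv_Suc)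
  have "sigma (n * q ^ e) * c + sigma n = sigma n * q ^ Suc e"
  proof (induction e)
    case 0
    show ?case by (simp add: c)
  next
    case (Suc e)
    have "sigma (n * q ^ Suc e) * c + sigma n = sigma n * q + q * (sigma (n * q ^ e) * c)"
      by (simp only: sigma_extend[OF assms]) (simp add: c algebra_simps)
    also have "\<dots> = q * (sigma (n * q ^ e) * c + sigma n)" by (simp add: algebra_simps)
    also have "\<dots> = sigma n * q ^ Suc (Suc e)" by (simp only: Suc.IH) simp
    finally show ?case .
  qed
  moreover have "sigma n * (q ^ Suc e - 1) + sigma n = sigma n * q ^ Suc e"
    using prime_gt_0_nat[OF assms(1)] by (simp add: diff_mult_distrib2)
  ultimately show ?thesis by (simp add: c)
qed

lemma prime_power_cofactor:
  fixes r q :: nat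
  assumes "0 < r" "q \<in> prime_factors r"
  obtains e r' where "r = q ^ e * r'" "0 < e" "0 < r'" "\<not> q dvd r'" "coprime q r'"
    "prime_factors r' = prime_factors r - {q}"
    "bigomega r = e + bigomega r'"
proof -
  define e where "e = multiplicity q r"
  have q: "prime q" "q dvd r" using assms by auto
  obtain r' where r': "r = q ^ e * r'" "\<not> q dvd r'"
    using multiplicity_decompose'[of r q] assms q unfolding e_def
    by (metis dvd_0_right not_prime_unit linorder_not_less bot_nat_0.extremum_strict)
  have e: "0 < e" using q assms(1) by (simp add: e_def prime_multiplicity_gt_zero_iff)
  have r0: "0 < r'" using r'(1) assms(1) by (cases r') auto
  have pf: "prime_factorization r = replicate_mset e q + prime_factorization r'"
    using r'(1) r0 q(1) prime_gt_0_nat[OF q(1)]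
    by (simp add: prime_factorization_mult prime_factorization_prime_power)
  have "q \<notin># prime_factorization r'" using r'(2) by auto
  hence "prime_factors r' = prime_factors r - {q}" using e by (auto simp: pf)
  moreover have "coprime q r'" using q(1) r'(2) prime_imp_coprime by blast
  ultimately show ?thesis using that r' e r0 pf by (simp add: bigomega_def)
qed

text \<open>Each prime power \<open>p ^ e\<close> in \<open>r\<close> multiplies sigma(n)/n by less
  than p/(p-1), which is at most q/(q-1).\<close>

lemma sigma_mult_le:
  assumes "0 < r" "0 < n" "coprime n r" "\<forall>p\<in>prime_factors r. q \<le> p"
    "card (prime_factors r) \<le> K" "0 < q"
  shows "sigma (n * r) * (q - 1) ^ K \<le> sigma n * r * q ^ K"
  using assms
proof (induction K arbitrary: n r)
  case 0
  hence "prime_factors r = {}" by simp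
  hence "r = 1" using "0.prems"(1) by (simp add: prime_factorization_empty_iff)
  thus ?case by simp
next
  case (Suc K)
  show ?case
  proof (cases "prime_factors r = {}")
    case True
    hence "r = 1" using Suc.prems(1) by (simp add: prime_factorization_empty_iff)
    moreover have "(q - 1) ^ Suc K \<le> q ^ Suc K" by (rule power_mono) auto
    ultimately show ?thesis by simp
  next
    case False
    then obtain p where p: "p \<in> prime_factors r" by blast
    obtain e r' where r: "r = p ^ e * r'" "0 < e" "0 < r'" "\<not> p dvd r'" "coprime p r'"
      "prime_factors r' = prime_factors r - {p}"
      using prime_power_cofactor[OF Suc.prems(1) p] by metis
    have pp: "prime p" "p dvd r" "q \<le> p" using p Suc.prems(4) by auto
    have pn: "\<not> p dvd n" using pp Suc.prems(3) by (meson coprime_common_divisor not_prime_unit)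
    let ?n = "n * p ^ e"
    have cop: "coprime ?n r'"
      using Suc.prems(3) r(1,5) by simp
    have card: "card (prime_factors r') \<le> K"
      using Suc.prems(5) p r(6) by (simp add: card_Diff_singleton)
    have IH: "sigma (?n * r') * (q - 1) ^ K \<le> sigma ?n * r' * q ^ K"
      by (rule Suc.IH) (use r Suc.prems cop card pp(1) in \<open>auto simp: prime_gt_0_nat\<close>)
    have step: "sigma ?n * (q - 1) \<le> sigma n * p ^ e * q"
    proof -
      have "sigma ?n * (p - 1) * (q - 1) \<le> sigma n * p ^ Suc e * (q - 1)"
        unfolding sigma_prime_power_mult[OF pp(1) pn Suc.prems(2)] by (intro mult_le_mono) auto
      also have "\<dots> = sigma n * p ^ e * (p * (q - 1))" by simp
      also have "p * (q - 1) \<le> q * (p - 1)"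
        using pp(3) by (simp add: diff_mult_distrib2 mult.commute)
      finally have "(sigma ?n * (q - 1)) * (p - 1) \<le> (sigma n * p ^ e * q) * (p - 1)"
        by (simp add: mult_ac)
      thus ?thesis using prime_gt_1_nat[OF pp(1)] by simp
    qed
    have "sigma (n * r) * (q - 1) ^ Suc K = sigma (?n * r') * (q - 1) ^ K * (q - 1)"
      by (simp add: r(1) mult_ac)
    also have "\<dots> \<le> sigma ?n * r' * q ^ K * (q - 1)" using IH by (rule mult_le_mono1)
    also have "\<dots> = (sigma ?n * (q - 1)) * (r' * q ^ K)" by simp
    also have "\<dots> \<le> (sigma n * p ^ e * q) * (r' * q ^ K)" using step by (rule mult_le_mono1)
    also have "\<dots> = sigma n * r * q ^ Suc K" by (simp add: r(1))
    finally show ?thesis .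
  qed
qed

text \<open>Otherwise the divisors other than \<open>m\<close> that lie outside \<open>T\<close>
  would add up to sigma(m) - (sigma(m) - 2m) - m = m.\<close>

lemma weird_imp_not_sum:
  assumes "weird m" "T \<subseteq> {d. d dvd m}" "m \<notin> T"
  shows "\<Sum>T \<noteq> sigma m - 2 * m"
proof
  assume T: "\<Sum>T = sigma m - 2 * m"
  have ab: "sigma m > 2 * m" and ns: "\<not> semiperfect m" using assms(1) by (auto simp: weird_def abundant_def)
  have "m \<noteq> 0" using ab by (auto simp: sigma_0 intro: gr0I)
  hence fin: "finite {d. d dvd m}" by simp
  hence finT: "finite T" using assms(2) finite_subset by blast
  let ?S = "{d. d dvd m} - T - {m}"
  have "\<Sum>({d. d dvd m} - T) + \<Sum>T = sigma m"
    unfolding sigma_def using sum.subset_diff[OF assms(2) fin, of id] by simp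
  moreover have "\<Sum>({d. d dvd m} - T) = m + \<Sum>?S"
    by (rule sum.remove) (use fin assms(3) in auto)
  ultimately have "m = \<Sum>?S" using T ab by simp
  moreover have "?S \<subseteq> {d. d dvd m \<and> d \<noteq> m}" by auto
  ultimately have "semiperfect m" using ab unfolding semiperfect_def abundant_def by blast
  thus False using ns by simp
qed

text \<open>A proper divisor with sigma(d) at least 2d is perfect or, by primitivity, semiperfect.
  Either way \<open>d\<close> is a sum of distinct proper divisors of \<open>d\<close>, and
  multiplying these by m/d makes \<open>m\<close> semiperfect.\<close>

lemma primitive_weird_deficient:
  assumes "primitive_weird m" "d dvd m" "d \<noteq> m"
  shows "sigma d < 2 * d"
proof (rule ccontr)
  assume "\<not> sigma d < 2 * d"
  hence ge: "2 * d \<le> sigma d" by simp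
  have w: "weird m" using assms(1) by (simp add: primitive_weird_def)
  have m0: "m \<noteq> 0" using w by (auto simp: weird_def abundant_def sigma_0 intro: gr0I)
  obtain c where c: "m = d * c" using assms(2) by blast
  have d0: "d > 0" "c > 0" using c m0 by auto
  have c1: "c > 1" using c assms(3) d0 by (cases "c = 1") auto
  have dm: "d < m" using c c1 d0 by simp
  have "\<exists>S \<subseteq> {x. x dvd d \<and> x \<noteq> d}. d = \<Sum>S"
  proof (cases "abundant d")
    case True
    hence "semiperfect d" using assms dm unfolding primitive_weird_def weird_def by blast
    thus ?thesis by (simp add: semiperfect_def)
  next
    case False
    hence "sigma d = 2 * d" using ge by (simp add: abundant_def)
    moreover have "sigma d = d + \<Sum>({x. x dvd d} - {d})"
      unfolding sigma_def by (rule sum.remove) (use d0 in auto)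
    ultimately have "d = \<Sum>({x. x dvd d} - {d})" by simp
    moreover have "{x. x dvd d} - {d} \<subseteq> {x. x dvd d \<and> x \<noteq> d}" by auto
    ultimately show ?thesis by blast
  qed
  then obtain S where S: "S \<subseteq> {x. x dvd d \<and> x \<noteq> d}" "d = \<Sum>S" by blast
  let ?S = "(*) c ` S"
  have "\<Sum>?S = (\<Sum>x\<in>S. c * x)"
    by (rule sum.reindex_cong[of "(*) c"]) (use d0 in \<open>auto simp: inj_on_def\<close>)
  also have "\<dots> = m" by (simp only: sum_distrib_left[symmetric] S(2)[symmetric]) (simp add: c)
  finally have "m = \<Sum>?S" by simp
  moreover have "?S \<subseteq> {x. x dvd m \<and> x \<noteq> m}"
    using S(1) d0 by (auto simp: c mult.commute)
  ultimately have "semiperfect m" using w unfolding semiperfect_def weird_def by blast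
  thus False using w by (simp add: weird_def)
qed

section \<open>The search\<close>

fun merge :: "nat list \<Rightarrow> nat list \<Rightarrow> nat list" where
  "merge [] ys = ys"
| "merge (x # xs) [] = x # xs"
| "merge (x # xs) (y # ys) = (if x < y then x # merge xs (y # ys) else y # merge (x # xs) ys)"

text \<open>The list counterpart of \<open>sigma_extend\<close>. Merging keeps ascending lists
  ascending, so that \<open>reach_upto\<close> can stop at the first entry above its target.\<close>

definition extend :: "nat \<Rightarrow> nat list \<Rightarrow> nat list \<Rightarrow> nat list" where
  "extend q D E = merge D (map ((*) q) E)"

fun has_factor :: "nat list \<Rightarrow> nat \<Rightarrow> bool" where
  "has_factor [] p = False"
| "has_factor (q # qs) p = (if p \<le> q then False else if p mod q = 0 then True else has_factor qs p)"

text \<open>A one-sided filter: a positive answer rules out primality, while a composite number with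
  larger prime factors only costs an extra check.\<close>

definition composite :: "nat \<Rightarrow> bool" where
  "composite p = has_factor [2, 3, 5, 7, 11, 13, 17, 19, 23, 29, 31] p"

text \<open>
  The second argument of \<open>reach\<close> is the sum of the list, an upper bound for what can still be reached.
\<close>

fun reach :: "nat list \<Rightarrow> nat \<Rightarrow> nat \<Rightarrow> bool" where
  "reach [] t x = (x = 0)"
| "reach (d # D) t x =
    (if t < x then False
     else if x < d then reach D (t - d) x
     else if reach D (t - d) (x - d) then True
     else reach D (t - d) x)"

text \<open>Selecting the usable entries reverses them, so that \<open>reach\<close> branches on the
  largest divisors first.\<close>

fun reach_upto :: "nat \<Rightarrow> nat list \<Rightarrow> nat list \<Rightarrow> nat \<Rightarrow> bool" where
  "reach_upto x [] E t = reach E t x"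
| "reach_upto x (d # D) E t = (if d \<le> x then reach_upto x D (d # E) (t + d) else reach E t x)"

definition subset_sum :: "nat \<Rightarrow> nat list \<Rightarrow> bool" where
  "subset_sum x D = reach_upto x D [] 0"

text \<open>
  A pair \<open>(a, l)\<close> stands for the interval \<open>{a..<a + l}\<close>.
\<close>

fun cons_iv :: "nat \<Rightarrow> nat \<Rightarrow> (nat \<times> nat) list \<Rightarrow> (nat \<times> nat) list" where
  "cons_iv a l [] = [(a, l)]"
| "cons_iv a l ((c, k) # I) =
    (if c \<le> a + l then cons_iv a (max l (c + k - a)) I else (a, l) # (c, k) # I)"

fun merge_iv :: "(nat \<times> nat) list \<Rightarrow> (nat \<times> nat) list \<Rightarrow> (nat \<times> nat) list" where
  "merge_iv [] J = J"
| "merge_iv ((a, l) # I) [] = (a, l) # I"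
| "merge_iv ((a, l) # I) ((c, k) # J) =
    (if a \<le> c then cons_iv a l (merge_iv I ((c, k) # J)) else cons_iv c k (merge_iv ((a, l) # I) J))"

fun shift_iv :: "nat \<Rightarrow> (nat \<times> nat) list \<Rightarrow> (nat \<times> nat) list" where
  "shift_iv d [] = []"
| "shift_iv d ((a, l) # I) = (a + d, l) # shift_iv d I"

text \<open>When \<open>d \<le> l\<close>, the interval and its translate by \<open>d\<close> leave
  no gap, so their union is again one interval.\<close>

fun grow :: "nat \<Rightarrow> (nat \<times> nat) list \<Rightarrow> (nat \<times> nat) list" where
  "grow d [] = []"
| "grow d ((a, l) # I) = (if d \<le> l then [(a, l + d)] else grow d I)"

text \<open>
  If \<open>grow d I\<close> is nonempty, the single extended interval is kept and the others are forgotten. The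
  constants \<open>300\<close> and \<open>4\<close> only bound the length of the lists; giving up is sound.
\<close>

fun add_iv :: "nat \<Rightarrow> (nat \<times> nat) list \<Rightarrow> (nat \<times> nat) list \<Rightarrow> (nat \<times> nat) list" where
  "add_iv d I [] = (if d \<le> 300 \<or> drop 4 I = [] then merge_iv I (shift_iv d I) else [])"
| "add_iv d I (x # J) = x # J"

fun sum_iv :: "(nat \<times> nat) list \<Rightarrow> nat list \<Rightarrow> (nat \<times> nat) list" where
  "sum_iv I [] = I"
| "sum_iv I (d # D) = sum_iv (add_iv d I (grow d I)) D"

text \<open>With s = sigma(n) and \<open>\<delta> = 2 * n - s\<close>, the target
  \<open>s - p * \<delta>\<close> is sigma(np) - 2np for a prime \<open>p\<close> not dividing
  \<open>n\<close>.\<close>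

definition check1 :: "nat \<Rightarrow> nat \<Rightarrow> nat list \<Rightarrow> nat \<Rightarrow> bool" where
  "check1 s \<delta> D p = (if composite p then True else subset_sum (s - p * \<delta>) (extend p D D))"

fun check_range :: "nat \<Rightarrow> nat \<Rightarrow> nat list \<Rightarrow> nat \<Rightarrow> nat \<Rightarrow> bool" where
  "check_range s \<delta> D p 0 = True"
| "check_range s \<delta> D p (Suc k) = (if check1 s \<delta> D p then check_range s \<delta> D (p + 1) k else False)"

text \<open>
  Ascending intervals for \<open>s - p * \<delta>\<close> correspond to descending ranges of \<open>p\<close>; \<open>H\<close> is the exclusive
  upper bound for the values of \<open>p\<close> that remain.
\<close>

fun sweep :: "nat \<Rightarrow> nat \<Rightarrow> nat list \<Rightarrow> nat \<Rightarrow> nat \<Rightarrow> (nat \<times> nat) list \<Rightarrow> bool" where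
  "sweep s \<delta> D L H [] = check_range s \<delta> D L (H - L)"
| "sweep s \<delta> D L H ((a, l) # I) =
    (if H \<le> L then True
     else if check_range s \<delta> D (max L ((s - a) div \<delta> + 1)) (H - max L ((s - a) div \<delta> + 1))
     then sweep s \<delta> D L (min H ((s + \<delta> - (a + l)) div \<delta>)) I
     else False)"

text \<open>Climbs through the numbers \<open>n * q ^ i\<close>. The first one that is not deficient
  is either perfect, hence neither primitive weird nor a proper divisor of a primitive weird number,
  or it is the only candidate for the number in question.\<close>

fun powers :: "nat \<Rightarrow> nat \<Rightarrow> nat \<Rightarrow> nat list \<Rightarrow> nat \<Rightarrow> nat \<Rightarrow> nat \<Rightarrow> nat list \<Rightarrow> bool" where
  "powers 0 n s D q n1 s1 D1 = True"
| "powers (Suc R) n s D q n1 s1 D1 =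
    (if s1 < 2 * n1 then powers R n s D q (q * n1) (s + q * s1) (extend q D D1)
     else if s1 = 2 * n1 then True
     else if n1 \<le> s1 - 2 * n1 then False
     else subset_sum (s1 - 2 * n1) D1)"

text \<open>The quotient \<open>(s - 1) div \<delta>\<close> is the largest \<open>p\<close> with
  \<open>p * \<delta> < s\<close>, the condition for \<open>n * p\<close> to be abundant. The
  initial interval \<open>(0, 1)\<close> stands for the empty sum.\<close>

definition last_prime :: "nat \<Rightarrow> nat \<Rightarrow> nat \<Rightarrow> nat \<Rightarrow> nat list \<Rightarrow> bool" where
  "last_prime L n s \<delta> D =
    (if (s - 1) div \<delta> < L then True
     else sweep s \<delta> D L ((s - 1) div \<delta> + 1) (sum_iv [(0, 1)] D))"

definition check_power :: "nat \<Rightarrow> nat \<Rightarrow> nat \<Rightarrow> nat \<Rightarrow> nat list \<Rightarrow> nat \<Rightarrow> bool" where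
  "check_power R L n s D q =
    (if q < L then True else if composite q then True else powers R n s D q (q * n) (s + q * s) (extend q D D))"

text \<open>
  If \<open>n * q\<close> is deficient and \<open>n * q ^ e\<close> is abundant, then \<open>2 * n - \<delta> < q * \<delta> < 2 * n\<close>, which leaves a
  single candidate for \<open>q\<close>.
\<close>

definition last_power :: "nat \<Rightarrow> nat \<Rightarrow> nat \<Rightarrow> nat \<Rightarrow> nat \<Rightarrow> nat list \<Rightarrow> bool" where
  "last_power R L n s \<delta> D = check_power R L n s D ((2 * n - 1) div \<delta>)"

definition last_check :: "nat \<Rightarrow> bool \<Rightarrow> nat \<Rightarrow> nat \<Rightarrow> nat \<Rightarrow> nat \<Rightarrow> nat list \<Rightarrow> bool" where
  "last_check R b L n s \<delta> D =
    (if last_power R L n s \<delta> D then if b then last_prime L n s \<delta> D else True else False)"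

section \<open>Recursion over the prime factors in increasing order\<close>

type_synonym checker = "nat \<Rightarrow> bool \<Rightarrow> nat \<Rightarrow> nat \<Rightarrow> nat \<Rightarrow> nat list \<Rightarrow> nat list \<Rightarrow> bool"

text \<open>
  Further primes \<open>p\<close> satisfy \<open>s0 div (2 * n0 - s0) < p\<close> because \<open>n0 * p\<close> is a proper divisor of the number in
  question and therefore deficient.
\<close>

fun exponents :: "checker \<Rightarrow> nat \<Rightarrow> bool \<Rightarrow> nat \<Rightarrow> nat \<Rightarrow> nat list \<Rightarrow> nat \<Rightarrow> nat list \<Rightarrow> nat \<Rightarrow> nat \<Rightarrow> nat list \<Rightarrow> bool" where
  "exponents f 0 b n s D q ps n0 s0 D0 = True"
| "exponents f (Suc R) b n s D q ps n0 s0 D0 =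
    (if R = 0 then True
     else if 2 * (q * n0) \<le> s + q * s0 then True
     else if f R b (max (q + 1) (s0 div (2 * n0 - s0) + 1)) (q * n0) (s + q * s0) (extend q D D0) ps
     then exponents f R True n s D q ps (q * n0) (s + q * s0) (extend q D D0)
     else False)"

fun mult_pow :: "nat \<Rightarrow> nat \<Rightarrow> nat \<Rightarrow> nat" where
  "mult_pow x q 0 = x"
| "mult_pow x q (Suc k) = mult_pow (x * q) q k"

text \<open>By \<open>sigma_mult_le\<close>, once the first test succeeds, no completion of
  \<open>n\<close> by at most \<open>K\<close> distinct primes, all at least \<open>q\<close>, is
  abundant. The empty list yields \<open>False\<close> because the primes beyond the list have not
  been excluded.\<close>

fun least_prime :: "checker \<Rightarrow> nat \<Rightarrow> nat \<Rightarrow> bool \<Rightarrow> nat \<Rightarrow> nat \<Rightarrow> nat list \<Rightarrow> nat list \<Rightarrow> bool" where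
  "least_prime f K R b n s D [] = False"
| "least_prime f K R b n s D (q # ps) =
    (if mult_pow s q K \<le> mult_pow (2 * n) (q - 1) K then True
     else if exponents f R b n s D q ps n s D then least_prime f K R b n s D ps
     else False)"

text \<open>Here \<open>K\<close> bounds the number of distinct primes still to come,
  \<open>R\<close> their number with multiplicity, and \<open>L\<close> is a lower bound for them.
  The flag \<open>b\<close> records that \<open>n\<close> already contains the square of an odd
  prime; without it a repeated prime must still appear, so \<open>R = 1\<close> leaves no
  room.\<close>

fun search :: "nat \<Rightarrow> checker" where
  "search 0 R b L n s D ps = True"
| "search (Suc K) R b L n s D ps =
    (if R = 0 then True else if \<not> b \<and> R = 1 then True
     else if last_check R b L n s (2 * n - s) D
     then if K = 0 then True else least_prime (search K) (Suc K) R b n s D (dropWhile (\<lambda>p. p < L) ps)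
     else False)"

text \<open>
  After deciding the condition of an \<open>if\<close>, the simplifier traverses the chosen branch again, including
  long lists that are already in normal form. The following code equations dispatch on a Boolean
  argument instead, which avoids these traversals.
\<close>

definition "merge_if c x xs y ys = (if c then x # merge xs (y # ys) else y # merge (x # xs) ys)"

lemma [code]:
  "merge [] ys = ys" "merge (x # xs) [] = x # xs"
  "merge (x # xs) (y # ys) = merge_if (x < y) x xs y ys"
  "merge_if True x xs y ys = x # merge xs (y # ys)"
  "merge_if False x xs y ys = y # merge (x # xs) ys"
  by (simp_all add: merge_if_def)

definition "reach_or c D t x = (if c then True else reach D t x)"
definition "reach_sub c D t x y = (if c then reach D t x else reach_or (reach D t y) D t x)"
definition "reach_if c d D t x = (if c then False else reach_sub (x < d) D (t - d) x (x - d))"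

lemma [code]:
  "reach [] t x = (x = 0)"
  "reach (d # D) t x = reach_if (t < x) d D t x"
  "reach_if True d D t x = False"
  "reach_if False d D t x = reach_sub (x < d) D (t - d) x (x - d)"
  "reach_sub True D t x y = reach D t x"
  "reach_sub False D t x y = reach_or (reach D t y) D t x"
  "reach_or True D t x = True"
  "reach_or False D t x = reach D t x"
  by (simp_all add: reach_if_def reach_sub_def reach_or_def)

definition "reach_upto_if b x d D E t = (if b then reach_upto x D (d # E) (t + d) else reach E t x)"

lemma [code]:
  "reach_upto x [] E t = reach E t x"
  "reach_upto x (d # D) E t = reach_upto_if (d \<le> x) x d D E t"
  "reach_upto_if True x d D E t = reach_upto x D (d # E) (t + d)"
  "reach_upto_if False x d D E t = reach E t x"
  by (simp_all add: reach_upto_if_def)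

definition "cons_if b a l c k I = (if b then cons_iv a (max l (c + k - a)) I else (a, l) # (c, k) # I)"

lemma [code]:
  "cons_iv a l [] = [(a, l)]"
  "cons_iv a l ((c, k) # I) = cons_if (c \<le> a + l) a l c k I"
  "cons_if True a l c k I = cons_iv a (max l (c + k - a)) I"
  "cons_if False a l c k I = (a, l) # (c, k) # I"
  by (simp_all add: cons_if_def)

definition "merge_iv_if b a l I c k J =
  (if b then cons_iv a l (merge_iv I ((c, k) # J)) else cons_iv c k (merge_iv ((a, l) # I) J))"

lemma [code]:
  "merge_iv [] J = J" "merge_iv ((a, l) # I) [] = (a, l) # I"
  "merge_iv ((a, l) # I) ((c, k) # J) = merge_iv_if (a \<le> c) a l I c k J"
  "merge_iv_if True a l I c k J = cons_iv a l (merge_iv I ((c, k) # J))"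
  "merge_iv_if False a l I c k J = cons_iv c k (merge_iv ((a, l) # I) J)"
  by (simp_all add: merge_iv_if_def)

definition "grow_if b d a l I = (if b then [(a, l + d)] else grow d I)"

lemma [code]:
  "grow d [] = []"
  "grow d ((a, l) # I) = grow_if (d \<le> l) d a l I"
  "grow_if True d a l I = [(a, l + d)]"
  "grow_if False d a l I = grow d I"
  by (simp_all add: grow_if_def)

section \<open>Soundness of the search\<close>

definition subset_sums :: "nat set \<Rightarrow> nat set" where
  "subset_sums A = {\<Sum>T | T. T \<subseteq> A}"

definition covered :: "(nat \<times> nat) list \<Rightarrow> nat set" where
  "covered I = (\<Union>(a, l)\<in>set I. {a..<a + l})"

definition state :: "nat \<Rightarrow> nat \<Rightarrow> nat list \<Rightarrow> bool" where
  "state n s D \<longleftrightarrow> 0 < n \<and> s = sigma n \<and> distinct D \<and> (\<forall>d\<in>set D. d dvd n)"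

lemma mset_merge: "mset (merge xs ys) = mset xs + mset ys"
  by (induction xs ys rule: merge.induct) auto

lemma state_extend:
  assumes "state n s D" "state (n * q ^ e) s' D'" "prime q" "\<not> q dvd n"
  shows "state (n * q ^ Suc e) (s + q * s') (extend q D D')"
proof -
  have q0: "0 < q" using assms(3) prime_gt_0_nat by blast
  have dD: "distinct D" "distinct D'" "\<forall>d\<in>set D. d dvd n" "\<forall>d\<in>set D'. d dvd n * q ^ e"
    using assms(1,2) by (auto simp: state_def)
  have ms: "mset (extend q D D') = mset (D @ map ((*) q) D')"
    by (simp add: extend_def mset_merge)
  have st: "set (extend q D D') = set D \<union> (*) q ` set D'"
    using mset_eq_setD[OF ms] by simp
  have "distinct (D @ map ((*) q) D')"
    using dD assms(4) q0 by (auto simp: distinct_map inj_on_def dest: dvd_mult_left)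
  hence "distinct (extend q D D')" using ms by (metis mset_eq_imp_distinct_iff)
  moreover have "\<forall>d\<in>set (extend q D D'). d dvd n * q ^ Suc e"
    using dD by (auto simp: st mult.left_commute intro: mult_dvd_mono)
  ultimately show ?thesis
    using sigma_extend[OF assms(3,4), of e] assms(1,2) q0 by (simp add: state_def)
qed

lemma prime_not_has_factor: "prime p \<Longrightarrow> 1 \<notin> set qs \<Longrightarrow> \<not> has_factor qs p"
proof (induction qs p rule: has_factor.induct)
  case (2 q qs p)
  have "\<not> q dvd p" if "\<not> p \<le> q"
  proof
    assume "q dvd p"
    hence "q = 1 \<or> q = p" using "2.prems"(1) unfolding prime_nat_iff by blast
    thus False using that "2.prems"(2) by auto
  qed
  thus ?case using 2 by (auto simp: mod_eq_0_iff_dvd)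
qed simp

lemma prime_not_composite: "prime p \<Longrightarrow> \<not> composite p"
  unfolding composite_def by (rule prime_not_has_factor) simp_all

lemma subset_sums_insert:
  assumes "finite A" "d \<notin> A" "x \<in> subset_sums A"
  shows "x \<in> subset_sums (insert d A)" "x + d \<in> subset_sums (insert d A)"
proof -
  obtain T where T: "T \<subseteq> A" "x = \<Sum>T" using assms(3) by (auto simp: subset_sums_def)
  show "x \<in> subset_sums (insert d A)" using T by (auto simp: subset_sums_def)
  have "\<Sum>(insert d T) = x + d" using T assms(1,2) finite_subset[OF T(1)] by (subst sum.insert) auto
  thus "x + d \<in> subset_sums (insert d A)" using T(1) unfolding subset_sums_def by (metis (mono_tags, lifting) insert_mono mem_Collect_eq)
qed

lemma reach_subset_sums: "reach D t x \<Longrightarrow> distinct D \<Longrightarrow> x \<in> subset_sums (set D)"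
proof (induction D t x rule: reach.induct)
  case (1 t x)
  thus ?case by (simp add: subset_sums_def)
next
  case (2 d D t x)
  have d: "d \<notin> set D" "distinct D" using "2.prems"(2) by auto
  have "x \<in> subset_sums (set D) \<or> (d \<le> x \<and> x - d \<in> subset_sums (set D))"
    using "2.IH" "2.prems"(1) d(2) by (simp split: if_splits)
  thus ?case
  proof (elim disjE conjE)
    assume "d \<le> x" "x - d \<in> subset_sums (set D)"
    thus ?thesis using subset_sums_insert(2)[OF _ d(1), of "x - d"] by simp
  qed (simp add: subset_sums_insert(1) d(1))
qed

lemma reach_upto_subset_sums:
  "reach_upto x D E t \<Longrightarrow> distinct (D @ E) \<Longrightarrow> x \<in> subset_sums (set D \<union> set E)"
proof (induction x D E t rule: reach_upto.induct)
  case (2 x d D E t)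
  show ?case
  proof (cases "d \<le> x")
    case True
    hence "x \<in> subset_sums (set D \<union> set (d # E))" using 2 by (intro "2.IH") auto
    thus ?thesis by simp
  next
    case False
    hence "x \<in> subset_sums (set E)" using 2 by (intro reach_subset_sums) auto
    thus ?thesis by (auto simp: subset_sums_def)
  qed
qed (auto intro: reach_subset_sums)

lemma subset_sum_subset_sums:
  assumes "subset_sum x D" "distinct D"
  shows "x \<in> subset_sums (set D)"
  using reach_upto_subset_sums[of x D "[]" 0] assms by (simp add: subset_sum_def)

lemma covered_Nil: "covered [] = {}"
  and covered_Cons: "covered ((a, l) # I) = {a..<a + l} \<union> covered I"
  by (simp_all add: covered_def)

lemma covered_cons_iv: "covered (cons_iv a l I) \<subseteq> {a..<a + l} \<union> covered I"
proof (induction a l I rule: cons_iv.induct)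
  case (2 a l c k I)
  show ?case
  proof (cases "c \<le> a + l")
    case True
    hence "{a..<a + max l (c + k - a)} \<subseteq> {a..<a + l} \<union> {c..<c + k}"
      by (auto simp: max_def split: if_splits)
    thus ?thesis using 2 True by (auto simp: covered_Cons)
  next
    case False
    thus ?thesis by (simp add: covered_Cons)
  qed
qed (simp add: covered_Nil covered_Cons)

lemma covered_merge_iv: "covered (merge_iv I J) \<subseteq> covered I \<union> covered J"
proof (induction I J rule: merge_iv.induct)
  case (3 a l I c k J)
  show ?case
  proof (cases "a \<le> c")
    case True
    thus ?thesis
      using "3.IH"(1) covered_cons_iv[of a l "merge_iv I ((c, k) # J)"]
      by (simp only: merge_iv.simps if_True covered_Cons) blast
  next
    case False
    thus ?thesis
      using "3.IH"(2) covered_cons_iv[of c k "merge_iv ((a, l) # I) J"]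
      by (simp only: merge_iv.simps if_False covered_Cons) blast
  qed
qed (auto simp: covered_Nil)

lemma covered_shift_iv: "covered (shift_iv d I) = (\<lambda>x. x + d) ` covered I"
proof (induction d I rule: shift_iv.induct)
  case (2 d a l I)
  have "{a + d..<a + d + l} = (\<lambda>x. x + d) ` {a..<a + l}"
    by (simp add: image_add_atLeastLessThan' add_ac)
  thus ?case using 2 by (simp only: shift_iv.simps covered_Cons image_Un)
qed (simp add: covered_Nil)

lemma covered_grow: "covered (grow d I) \<subseteq> covered I \<union> (\<lambda>x. x + d) ` covered I"
proof (induction d I rule: grow.induct)
  case (2 d a l I)
  let ?C = "covered ((a, l) # I)"
  show ?case
  proof (cases "d \<le> l")
    case True
    have "v \<in> ?C \<union> (\<lambda>x. x + d) ` ?C" if v: "v \<in> {a..<a + (l + d)}" for v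
    proof (cases "v < a + l")
      case False
      hence "v = (v - d) + d" "v - d \<in> ?C" using v True by (auto simp: covered_Cons)
      thus ?thesis by blast
    qed (use v in \<open>simp add: covered_Cons\<close>)
    hence "{a..<a + (l + d)} \<subseteq> ?C \<union> (\<lambda>x. x + d) ` ?C" by blast
    moreover have "covered (grow d ((a, l) # I)) = {a..<a + (l + d)}"
      using True by (simp add: covered_Nil covered_Cons)
    ultimately show ?thesis by (simp only:)
  next
    case False
    hence "covered (grow d ((a, l) # I)) = covered (grow d I)" by simp
    also have "\<dots> \<subseteq> covered I \<union> (\<lambda>x. x + d) ` covered I" using False by (rule 2)
    also have "\<dots> \<subseteq> ?C \<union> (\<lambda>x. x + d) ` ?C"
      unfolding covered_Cons by (intro Un_mono image_mono) simp_all
    finally show ?thesis .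
  qed
qed (simp add: covered_Nil)

lemma covered_add_iv:
  "covered (add_iv d I (grow d I)) \<subseteq> covered I \<union> (\<lambda>x. x + d) ` covered I"
proof (cases "grow d I")
  case Nil
  have "covered (add_iv d I []) \<subseteq> covered (merge_iv I (shift_iv d I))"
    by (simp add: covered_Nil)
  also have "\<dots> \<subseteq> covered I \<union> (\<lambda>x. x + d) ` covered I"
    using covered_merge_iv[of I "shift_iv d I"] by (simp only: covered_shift_iv)
  finally show ?thesis by (simp only: Nil)
next
  case (Cons i J)
  thus ?thesis using covered_grow[of d I] by simp
qed

lemma covered_sum_iv:
  "\<lbrakk>covered I \<subseteq> subset_sums A; finite A; distinct D; set D \<inter> A = {}\<rbrakk>
    \<Longrightarrow> covered (sum_iv I D) \<subseteq> subset_sums (A \<union> set D)"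
proof (induction I D arbitrary: A rule: sum_iv.induct)
  case (2 I d D)
  have "covered (add_iv d I (grow d I)) \<subseteq> subset_sums (insert d A)"
  proof
    fix x assume "x \<in> covered (add_iv d I (grow d I))"
    then consider "x \<in> subset_sums A" | y where "x = y + d" "y \<in> subset_sums A"
      using covered_add_iv[of d I] "2.prems"(1) by blast
    thus "x \<in> subset_sums (insert d A)"
      by cases (use subset_sums_insert[of A d] "2.prems"(2,4) in simp_all)
  qed
  hence "covered (sum_iv (add_iv d I (grow d I)) D) \<subseteq> subset_sums (insert d A \<union> set D)"
    by (intro "2.IH") (use "2.prems" in auto)
  thus ?case by simp
qed simp

lemma check_rangeD: "check_range s \<delta> D p k \<Longrightarrow> p \<le> x \<Longrightarrow> x < p + k \<Longrightarrow> check1 s \<delta> D x"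
proof (induction s \<delta> D p k rule: check_range.induct)
  case (2 s \<delta> D p k)
  thus ?case by (cases "p = x") (simp_all split: if_splits)
qed simp

text \<open>For the first interval, \<open>p\<close> is too large and checked individually, or its
  value falls into the interval, or \<open>p\<close> is too small and is left to the recursive
  call.\<close>

lemma sweep_sound:
  assumes "sweep s \<delta> D L H I" "covered I \<subseteq> subset_sums A" "L \<le> p" "p < H" "p * \<delta> < s" "0 < \<delta>" "0 < p"
  shows "check1 s \<delta> D p \<or> s - p * \<delta> \<in> subset_sums A"
  using assms
proof (induction s \<delta> D L H I rule: sweep.induct)
  case (1 s \<delta> D L H)
  thus ?case using check_rangeD by simp
next
  case (2 s \<delta> D L H a l I)
  let ?p = "max L ((s - a) div \<delta> + 1)"
  let ?H = "min H ((s + \<delta> - (a + l)) div \<delta>)"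
  have all: "check_range s \<delta> D ?p (H - ?p)"
    and rest: "sweep s \<delta> D L ?H I"
    using "2.prems"(1,3,4) by (simp_all split: if_splits)
  consider "(s - a) div \<delta> < p" | "p \<le> (s - a) div \<delta>" "p < (s + \<delta> - (a + l)) div \<delta>"
    | "p \<le> (s - a) div \<delta>" "(s + \<delta> - (a + l)) div \<delta> \<le> p" by linarith
  thus ?case
  proof cases
    case 1
    thus ?thesis using check_rangeD[OF all, of p] "2.prems"(3,4) by simp
  next
    case less: 2
    show ?thesis
    proof (rule "2.IH")
      show "\<not> H \<le> L" using "2.prems"(3,4) by simp
      show "covered I \<subseteq> subset_sums A" using "2.prems"(2) by (simp add: covered_Cons)
      show "p < ?H" using less(2) "2.prems"(4) by simp
    qed (use all rest "2.prems" in simp_all)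
  next
    case 3
    have "p * \<delta> \<le> s - a" using 3(1) "2.prems"(6) by (simp add: less_eq_div_iff_mult_less_eq)
    \<comment> \<open>Adding \<open>\<delta>\<close> before dividing makes the quotient the least
      \<open>p\<close> with \<open>s < a + l + p * \<delta>\<close>; if the subtraction truncates,
      every \<open>p\<close> satisfies this.\<close>
    moreover have "s + \<delta> - (a + l) < p * \<delta> + \<delta>"
      using 3(2) "2.prems"(6) div_less_iff_less_mult[of \<delta> "s + \<delta> - (a + l)" "p + 1"] by simp
    \<comment> \<open>Positivity excludes the truncated case \<open>s < a\<close> in the bound
      \<open>p * \<delta> \<le> s - a\<close>.\<close>
    moreover have "0 < p * \<delta>" using "2.prems"(6,7) by simp
    ultimately have "s - p * \<delta> \<in> {a..<a + l}" using "2.prems"(5) by (simp; linarith)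
    thus ?thesis using "2.prems"(2) by (auto simp: covered_Cons)
  qed
qed

section \<open>Primitive weird numbers and the last prime power\<close>

lemma stateD:
  assumes "state n s D"
  shows "0 < n" "s = sigma n" "distinct D" "\<And>d. d \<in> set D \<Longrightarrow> d dvd n"
  using assms by (auto simp: state_def)

lemma primitive_weirdD:
  assumes "primitive_weird m"
  shows "weird m" "0 < m" "2 * m < sigma m"
  using assms by (auto simp: primitive_weird_def weird_def abundant_def sigma_0 intro: gr0I)

lemma primitive_weird_not_subset_sum:
  assumes "primitive_weird m" "finite A" "\<forall>d\<in>A. d dvd m" "m \<notin> A \<or> sigma m - 2 * m < m"
  shows "sigma m - 2 * m \<notin> subset_sums A"
proof
  assume "sigma m - 2 * m \<in> subset_sums A"
  then obtain T where T: "T \<subseteq> A" "\<Sum>T = sigma m - 2 * m" by (auto simp: subset_sums_def)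
  have "m \<notin> T"
  proof
    assume "m \<in> T"
    hence "m \<le> \<Sum>T" using T(1) assms(2) finite_subset by (intro member_le_sum) auto
    thus False using T assms(4) \<open>m \<in> T\<close> by auto
  qed
  moreover have "T \<subseteq> {d. d dvd m}" using T(1) assms(3) by blast
  ultimately show False
    using weird_imp_not_sum T(2) primitive_weirdD(1)[OF assms(1)] by blast
qed

lemma last_prime_sound:
  assumes "last_prime L n s \<delta> D" "state n s D" "s < 2 * n" "\<delta> = 2 * n - s"
    and "prime p" "\<not> p dvd n" "L \<le> p"
  shows "\<not> primitive_weird (n * p)"
proof
  assume pw: "primitive_weird (n * p)"
  note st = stateD[OF assms(2)]
  have p1: "1 < p" using assms(5) prime_gt_1_nat by blast
  have \<delta>: "0 < \<delta>" "2 * n = s + \<delta>" using assms(3,4) by auto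
  have "sigma (n * p) = s + p * s" using sigma_extend[OF assms(5,6) st(1), of 0] st(2) by simp
  moreover have "2 * (n * p) = p * s + p * \<delta>"
    using \<delta>(2) by (metis add_mult_distrib mult.assoc mult.commute)
  ultimately have ab: "p * \<delta> < s" and \<Delta>: "sigma (n * p) - 2 * (n * p) = s - p * \<delta>"
    using primitive_weirdD(3)[OF pw] by auto
  have le: "p \<le> (s - 1) div \<delta>" using ab \<delta>(1) by (simp add: less_eq_div_iff_mult_less_eq)
  hence sw: "sweep s \<delta> D L ((s - 1) div \<delta> + 1) (sum_iv [(0, 1)] D)"
    using assms(1,7) by (auto simp: last_prime_def split: if_splits)
  have "covered (sum_iv [(0, 1)] D) \<subseteq> subset_sums ({} \<union> set D)"
    by (rule covered_sum_iv) (use st(3) in \<open>auto simp: covered_def subset_sums_def\<close>)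
  hence "check1 s \<delta> D p \<or> s - p * \<delta> \<in> subset_sums (set D)"
    using sweep_sound[OF sw] assms(7) le ab \<delta>(1) p1 by simp
  moreover have "s - p * \<delta> \<notin> subset_sums (set D)"
  proof -
    have "n * p \<notin> set D"
      using st(1,4) p1 by (metis dvd_imp_le less_le_not_le mult.right_neutral mult_less_cancel1)
    thus ?thesis
      using primitive_weird_not_subset_sum[OF pw, of "set D"] st(4) \<Delta> by auto
  qed
  moreover have "\<not> check1 s \<delta> D p"
  proof
    assume "check1 s \<delta> D p"
    hence ss: "subset_sum (s - p * \<delta>) (extend p D D)"
      using prime_not_composite[OF assms(5)] by (simp add: check1_def)
    have st': "state (n * p) (s + p * s) (extend p D D)"
      using state_extend[of n s D p 0 s D] assms by simp
    \<comment> \<open>The extended list may contain \<open>n * p\<close> itself, so the target has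
      to be smaller.\<close>
    have "s - p * \<delta> < n * p"
    proof -
      have "s - p * \<delta> < 2 * n" using assms(3) by simp
      also have "2 * n \<le> n * p" using p1 by simp
      finally show ?thesis .
    qed
    thus False
      using subset_sum_subset_sums[OF ss stateD(3)[OF st']] stateD(4)[OF st']
        primitive_weird_not_subset_sum[OF pw, of "set (extend p D D)"] \<Delta> by auto
  qed
  ultimately show False by blast
qed

lemma powers_sound:
  assumes "powers R n s D q n1 s1 D1" "state n s D" "n1 = n * q ^ i" "state n1 s1 D1"
    and "prime q" "\<not> q dvd n" "primitive_weird (n * q ^ e)" "i \<le> e" "e < R + i"
  shows False
  using assms
proof (induction R n s D q n1 s1 D1 arbitrary: i rule: powers.induct)
  case (2 R n s D q n1 s1 D1)
  have q1: "1 < q" using "2.prems"(5) prime_gt_1_nat by blast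
  have s1: "s1 = sigma n1" "0 < n1" using stateD[OF "2.prems"(4)] by auto
  show ?case
  proof (cases "s1 < 2 * n1")
    case True
    hence "i \<noteq> e" using "2.prems"(3,7) s1 primitive_weirdD(3) by fastforce
    hence "Suc i \<le> e" using "2.prems"(8) by simp
    moreover have "state (q * n1) (s + q * s1) (extend q D D1)"
      using state_extend[of n s D q i s1 D1] "2.prems"(2-6) by (simp add: mult_ac)
    ultimately show ?thesis
      using "2.IH"[OF True, of "Suc i"] True "2.prems" by (simp add: mult_ac)
  next
    case False
    \<comment> \<open>A number that is not deficient cannot be a proper divisor, so the climb has
      arrived.\<close>
    have "i = e"
    proof (rule ccontr)
      assume "i \<noteq> e"
      hence "i < e" using "2.prems"(8) by simp
      hence "n1 dvd n * q ^ e" "n1 \<noteq> n * q ^ e"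
        using "2.prems"(3) q1 s1(2) by (auto intro: le_imp_power_dvd)
      hence "sigma n1 < 2 * n1" by (rule primitive_weird_deficient[OF "2.prems"(7)])
      thus False using False s1 by simp
    qed
    hence pw: "primitive_weird n1" using "2.prems"(3,7) by simp
    have "s1 \<noteq> 2 * n1" using primitive_weirdD(3)[OF pw] s1 by simp
    hence "\<not> n1 \<le> s1 - 2 * n1" "subset_sum (s1 - 2 * n1) D1"
      using "2.prems"(1) False by (auto split: if_splits)
    thus ?thesis
      using subset_sum_subset_sums[OF _ stateD(3)[OF "2.prems"(4)]] stateD(4)[OF "2.prems"(4)]
        primitive_weird_not_subset_sum[OF pw, of "set D1"] s1(1) by auto
  qed
qed simp

lemma last_power_sound:
  assumes "last_power R L n s \<delta> D" "state n s D" "s < 2 * n" "\<delta> = 2 * n - s"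
    and "prime q" "\<not> q dvd n" "L \<le> q" "2 \<le> e" "e \<le> R"
  shows "\<not> primitive_weird (n * q ^ e)"
proof
  assume pw: "primitive_weird (n * q ^ e)"
  note st = stateD[OF assms(2)]
  have q1: "1 < q" using assms(5) prime_gt_1_nat by blast
  have \<delta>: "0 < \<delta>" "2 * n = s + \<delta>" using assms(3,4) by auto
  have "sigma (n * q) < 2 * (n * q)"
  proof (rule primitive_weird_deficient[OF pw])
    show "n * q dvd n * q ^ e" using assms(8) by (simp add: dvd_power)
    show "n * q \<noteq> n * q ^ e"
      using assms(8) q1 st(1) power_strict_increasing[of 1 e q] by auto
  qed
  moreover have "sigma (n * q) = s + q * s"
    using sigma_extend[OF assms(5,6) st(1), of 0] st(2) by simp
  moreover have "2 * (n * q) = q * (2 * n)" by simp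
  ultimately have "s + q * s < q * (s + \<delta>)" unfolding \<delta>(2) by linarith
  hence lower: "2 * n < (q + 1) * \<delta>" using \<delta>(2) by (simp add: algebra_simps)
  \<comment> \<open>Abundance of \<open>n * q ^ e\<close> and sigma(q^e)/q^e < q/(q-1) give
    \<open>2 * n * (q - 1) < s * q\<close>, that is, \<open>(q - 1) * \<delta> < s\<close>.\<close>
  have upper: "q * \<delta> < 2 * n"
  proof (rule ccontr)
    assume "\<not> q * \<delta> < 2 * n"
    hence ge: "s + \<delta> \<le> q * \<delta>" using \<delta>(2) by linarith
    define c where "c = q - 1"
    have c: "q = c + 1" using q1 by (simp add: c_def)
    have "s \<le> c * \<delta>" using ge unfolding c by (simp add: add_mult_distrib)
    have "2 * (n * q ^ e) * c < sigma (n * q ^ e) * c"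
      using primitive_weirdD(3)[OF pw] q1 by (intro mult_less_mono1) (auto simp: c_def)
    also have "\<dots> = s * (q ^ Suc e - 1)"
      unfolding c_def st(2) by (rule sigma_prime_power_mult[OF assms(5,6) st(1)])
    also have "\<dots> \<le> s * q ^ Suc e" by (intro mult_le_mono2) (rule diff_le_self)
    also have "\<dots> = (s * q) * q ^ e" by (simp only: power_Suc mult.assoc)
    finally have "(2 * n * c) * q ^ e < (s * q) * q ^ e" by (simp only: mult_ac)
    hence "2 * n * c < s * q" by (simp only: mult_less_cancel2)
    hence "(s + \<delta>) * c < s * (c + 1)" unfolding \<delta>(2) using c by simp
    hence "c * \<delta> < s" by (simp add: algebra_simps)
    thus False using \<open>s \<le> c * \<delta>\<close> by linarith
  qed
  have "(2 * n - 1) div \<delta> = q"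
  proof (rule div_nat_eqI)
    show "\<delta> * q \<le> 2 * n - 1" using upper by (simp add: mult.commute)
    show "2 * n - 1 < \<delta> * Suc q" using lower by (simp add: mult.commute)
  qed
  hence pows: "powers R n s D q (q * n) (s + q * s) (extend q D D)"
    using assms(1,7) prime_not_composite[OF assms(5)]
    by (auto simp: last_power_def check_power_def split: if_splits)
  have st1: "state (q * n) (s + q * s) (extend q D D)"
    using state_extend[of n s D q 0 s D] assms by (simp add: mult.commute)
  show False
    by (rule powers_sound[OF pows assms(2) _ st1 assms(5,6) pw, of 1]) (use assms(8,9) in auto)
qed

section \<open>Correctness of the recursion over prime factors\<close>

definition excluded :: "nat \<Rightarrow> nat \<Rightarrow> bool \<Rightarrow> nat \<Rightarrow> nat \<Rightarrow> bool" where
  "excluded K R b L n \<longleftrightarrow> (\<forall>r. 0 < r \<longrightarrow> coprime n r \<longrightarrow> (\<forall>p\<in>prime_factors r. L \<le> p) \<longrightarrow>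
     card (prime_factors r) \<le> K \<longrightarrow> bigomega r \<le> R \<longrightarrow>
     b \<or> card (prime_factors r) < bigomega r \<longrightarrow> \<not> primitive_weird (n * r))"

text \<open>A finite list suffices: a prime from \<open>L\<close> on that is missing lies beyond all
  entries, so an estimate that stops the search at some entry applies to it as well.\<close>

definition prime_list :: "nat \<Rightarrow> nat list \<Rightarrow> bool" where
  "prime_list L ps \<longleftrightarrow> sorted_wrt (<) ps \<and> (\<forall>x\<in>set ps. 1 < x) \<and>
     (\<forall>p. prime p \<longrightarrow> L \<le> p \<longrightarrow> p \<in> set ps \<or> (\<forall>x\<in>set ps. x < p))"

definition sound :: "nat \<Rightarrow> checker \<Rightarrow> bool" where
  "sound K f \<longleftrightarrow> (\<forall>R b L n s D ps. f R b L n s D ps \<longrightarrow> state n s D \<longrightarrow> s < 2 * n \<longrightarrow>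
     prime_list L ps \<longrightarrow> excluded K R b L n)"

text \<open>The induction raises \<open>i\<close> until the next factor \<open>q\<close> completes
  \<open>q ^ e\<close>; then \<open>f\<close> takes over the cofactor \<open>r\<close>. If the
  exponent continues to grow, \<open>q\<close> is repeated, which justifies setting the flag to
  \<open>True\<close>.\<close>

lemma exponents_sound:
  assumes "exponents f R b n s D q ps n0 s0 D0" "sound K f" "state n s D"
    and "n0 = n * q ^ i" "state n0 s0 D0" "s0 < 2 * n0" "prime q" "\<not> q dvd n"
    and "prime_list (q + 1) ps" "primitive_weird (n * (q ^ e * r))" "i < e"
    and "1 < r" "coprime (n * q) r" "\<forall>p\<in>prime_factors r. q < p" "card (prime_factors r) \<le> K"
    and "e + bigomega r \<le> R + i" "b \<or> Suc i < e \<or> card (prime_factors r) < bigomega r"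
  shows False
  using assms
proof (induction f R b n s D q ps n0 s0 D0 arbitrary: i rule: exponents.induct)
  case (2 f R b n s D q ps n0 s0 D0)
  let ?m = "n * (q ^ e * r)" and ?n1 = "q * n0" and ?s1 = "s + q * s0" and ?D1 = "extend q D D0"
  let ?L = "max (q + 1) (s0 div (2 * n0 - s0) + 1)"
  have q1: "1 < q" using "2.prems"(7) prime_gt_1_nat by blast
  have n0: "0 < n" "0 < n0" using stateD(1) "2.prems"(3,5) by auto
  have "prime_factors r \<noteq> {}" using "2.prems"(12) by (auto simp: prime_factorization_empty_iff)
  hence "0 < bigomega r" by (auto simp: bigomega_def nonempty_has_size)
  hence R: "R \<noteq> 0" using "2.prems"(11,16) by auto
  have n1: "?n1 = n * q ^ Suc i" using "2.prems"(4) by simp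
  have st: "state ?n1 ?s1 ?D1"
    unfolding n1 using state_extend[OF "2.prems"(3) _ "2.prems"(7,8)] "2.prems"(4,5) by simp
  have dvd: "n0 * q dvd n * q ^ e"
  proof -
    have "n * q ^ Suc i dvd n * q ^ e"
      using "2.prems"(11) by (intro mult_dvd_mono dvd_refl le_imp_power_dvd) simp
    thus ?thesis unfolding "2.prems"(4) by (simp only: power_Suc mult_ac)
  qed
  have m: "?m = (n * q ^ e) * r" by (rule mult.assoc[symmetric])
  have dvd_m: "?n1 dvd ?m"
    unfolding m mult.commute[of q n0] by (rule dvd_mult2[OF dvd])
  have ne0: "0 < n * q ^ e" using n0 q1 by simp
  have "?n1 \<noteq> ?m"
  proof -
    have "?n1 \<le> n * q ^ e" unfolding mult.commute[of q n0] by (rule dvd_imp_le[OF dvd ne0])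
    also have "\<dots> < n * q ^ e * r" using mult_less_mono2[OF "2.prems"(12) ne0] by simp
    finally show ?thesis unfolding m by (rule less_imp_neq)
  qed
  hence def: "?s1 < 2 * ?n1"
    using primitive_weird_deficient[OF "2.prems"(10) dvd_m] stateD(2)[OF st] by simp
  have f: "f R b ?L ?n1 ?s1 ?D1 ps" and rec: "exponents f R True n s D q ps ?n1 ?s1 ?D1"
    using "2.prems"(1) R def by (auto split: if_splits)
  show ?case
  proof (cases "e = Suc i")
    case True
    have "prime_list ?L ps" using "2.prems"(9) by (auto simp: prime_list_def)
    hence ex: "excluded K R b ?L ?n1"
      using "2.prems"(2) f st def by (auto simp: sound_def)
    have "\<forall>p\<in>prime_factors r. ?L \<le> p"
    proof
      fix p assume p: "p \<in> prime_factors r"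
      hence p': "prime p" "p dvd r" "q < p" using "2.prems"(14) by auto
      have "\<not> p dvd n0"
      proof
        assume "p dvd n0"
        hence "p dvd n \<or> p dvd q"
          using p'(1) "2.prems"(4) prime_dvd_mult_iff prime_dvd_power by blast
        hence "p dvd n * q" by auto
        thus False using p' "2.prems"(13) by (meson coprime_common_divisor not_prime_unit)
      qed
      have "sigma (n0 * p) < 2 * (n0 * p)"
      proof (rule primitive_weird_deficient[OF "2.prems"(10)])
        \<comment> \<open>Even \<open>n0 * p * q\<close> divides the number in question, so
          \<open>n0 * p\<close> is a proper divisor.\<close>
        have *: "(n0 * q) * p dvd ?m" unfolding m by (rule mult_dvd_mono[OF dvd p'(2)])
        have "n0 * p dvd (n0 * q) * p" by simp
        thus "n0 * p dvd ?m" using * by (rule dvd_trans)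
        show "n0 * p \<noteq> ?m"
        proof
          assume eq: "n0 * p = ?m"
          have pos: "0 < n0 * p" using n0 p'(1) prime_gt_0_nat by simp
          have "(n0 * q) * p \<le> n0 * p" using * unfolding eq[symmetric] by (rule dvd_imp_le[OF _ pos])
          hence "(n0 * p) * q \<le> (n0 * p) * 1" by (simp only: mult_ac mult_1_right)
          thus False using pos q1 by simp
        qed
      qed
      hence "s0 + p * s0 < 2 * (n0 * p)"
        using sigma_extend[OF p'(1) \<open>\<not> p dvd n0\<close> n0(2), of 0] stateD(2)[OF "2.prems"(5)] by simp
      moreover obtain \<delta> where \<delta>: "2 * n0 = s0 + \<delta>" "0 < \<delta>"
        using "2.prems"(6) by (metis less_imp_add_positive)
      moreover have "2 * (n0 * p) = p * s0 + p * \<delta>"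
        using \<delta>(1) by (metis add_mult_distrib mult.assoc mult.commute)
      ultimately have "s0 < p * \<delta>" by simp
      hence "s0 div \<delta> < p" using \<delta>(2) by (simp add: div_less_iff_less_mult)
      thus "?L \<le> p" using p'(3) \<delta>(1) by simp
    qed
    moreover have "coprime ?n1 r" using "2.prems"(13) unfolding n1 by simp
    moreover have "bigomega r \<le> R" using "2.prems"(16) True by simp
    moreover have "b \<or> card (prime_factors r) < bigomega r" using "2.prems"(17) True by simp
    moreover have "0 < r" using "2.prems"(12) by simp
    ultimately have "\<not> primitive_weird (?n1 * r)"
      using ex "2.prems"(15) unfolding excluded_def by blast
    moreover have "?n1 * r = ?m" unfolding n1 using True by (simp add: mult.assoc)
    ultimately show ?thesis using "2.prems"(10) by simp
  next
    case False
    show ?thesis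
      by (rule "2.IH"[of "Suc i"]) (use "2.prems" R def f rec st n1 False in auto)
  qed
qed simp

lemma mult_pow_eq: "mult_pow x q k = x * q ^ k"
  by (induction x q k rule: mult_pow.induct) simp_all

text \<open>A successful run cannot exhaust the list. It stops by the estimate at an entry not above
  \<open>q\<close>, or it treats \<open>q\<close> itself.\<close>

lemma least_prime_cases:
  assumes "least_prime f K R b n s D ps" "sorted_wrt (<) ps" "q \<in> set ps \<or> (\<forall>x\<in>set ps. x < q)"
  obtains q' where "q' \<in> set ps" "q' \<le> q" "s * q' ^ K \<le> 2 * n * (q' - 1) ^ K"
  | us qs where "ps = us @ q # qs" "exponents f R b n s D q qs n s D"
proof -
  have "(\<exists>q'\<in>set ps. q' \<le> q \<and> s * q' ^ K \<le> 2 * n * (q' - 1) ^ K) \<or>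
    (\<exists>us qs. ps = us @ q # qs \<and> exponents f R b n s D q qs n s D)"
    using assms
  proof (induction f K R b n s D ps rule: least_prime.induct)
    case (2 f K R b n s D p ps)
    consider "s * p ^ K \<le> 2 * n * (p - 1) ^ K" | "exponents f R b n s D p ps n s D" "least_prime f K R b n s D ps"
      "\<not> s * p ^ K \<le> 2 * n * (p - 1) ^ K"
      using "2.prems"(1) by (auto simp: mult_pow_eq split: if_splits)
    thus ?case
    proof cases
      case 1
      moreover have "p \<le> q" using "2.prems"(2,3) by fastforce
      ultimately show ?thesis by auto
    next
      case 2
      show ?thesis
      proof (cases "p = q")
        case True
        have "p # ps = [] @ q # ps" using True by simp
        thus ?thesis using 2(1) True by blast
      next
        case False
        hence "q \<in> set ps \<or> (\<forall>x\<in>set ps. x < q)" using "2.prems"(3) by auto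
        moreover have "sorted_wrt (<) ps" using "2.prems"(2) by simp
        moreover have "\<not> mult_pow s p K \<le> mult_pow (2 * n) (p - 1) K" using 2(3) by (simp add: mult_pow_eq)
        ultimately consider "\<exists>q'\<in>set ps. q' \<le> q \<and> s * q' ^ K \<le> 2 * n * (q' - 1) ^ K"
          | us qs where "ps = us @ q # qs" "exponents f R b n s D q qs n s D"
          using "2.IH" 2(1,2) by blast
        thus ?thesis
        proof cases
          case (2 us qs)
          hence "p # ps = (p # us) @ q # qs" by simp
          thus ?thesis using 2(2) by blast
        qed auto
      qed
    qed
  qed simp
  thus ?thesis using that by blast
qed

lemma prime_list_dropWhile:
  assumes "prime_list L ps"
  shows "prime_list L (dropWhile (\<lambda>p. p < L) ps)"
proof -
  have "sorted_wrt (<) (dropWhile (\<lambda>p. p < L) ps)"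
    using assms sorted_wrt_append[of "(<)" "takeWhile (\<lambda>p. p < L) ps"]
    by (simp add: prime_list_def)
  moreover have "p \<in> set (dropWhile (\<lambda>p. p < L) ps)" if "p \<in> set ps" "L \<le> p" for p
    using that set_takeWhileD[of p "\<lambda>p. p < L" ps] by (metis Un_iff linorder_not_less set_append takeWhile_dropWhile_id)
  moreover have "set (dropWhile (\<lambda>p. p < L) ps) \<subseteq> set ps" using set_dropWhileD by fast
  ultimately show ?thesis using assms unfolding prime_list_def by blast
qed

lemma prime_list_suffix:
  assumes "prime_list L (us @ q # qs)" "L \<le> q"
  shows "prime_list (q + 1) qs"
proof -
  have srt: "sorted_wrt (<) qs" "\<forall>x\<in>set us. x < q" "\<forall>x\<in>set qs. 1 < x"
    using assms(1) by (simp_all add: prime_list_def sorted_wrt_append)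
  have "p \<in> set qs \<or> (\<forall>x\<in>set qs. x < p)" if p: "prime p" "q + 1 \<le> p" for p
  proof -
    have "p \<in> set (us @ q # qs) \<or> (\<forall>x\<in>set (us @ q # qs). x < p)"
      using assms p unfolding prime_list_def by (meson add_leD1 order_trans)
    moreover have "p \<notin> set us" "p \<noteq> q" using srt(2) p(2) by auto
    ultimately show ?thesis by auto
  qed
  thus ?thesis using srt unfolding prime_list_def by blast
qed

text \<open>Split off the full power \<open>q ^ e\<close> of the least prime of \<open>r\<close>. If
  nothing remains, \<open>last_prime\<close> or \<open>last_power\<close> decides, according to
  whether \<open>e = 1\<close>; otherwise \<open>least_prime\<close> applies, and the induction
  hypothesis handles the cofactor.\<close>

lemma search_sound: "sound K (search K)"
proof (induction K)
  case 0
  have "\<not> primitive_weird (n * r)"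
    if "sigma n < 2 * n" "0 < r" "card (prime_factors r) \<le> 0" for n r
  proof
    assume "primitive_weird (n * r)"
    moreover have "r = 1" using that(2,3) by (simp add: prime_factorization_empty_iff)
    ultimately show False using that(1) primitive_weirdD(3)[of n] by simp
  qed
  thus ?case by (auto simp: sound_def excluded_def state_def simp del: card_0_eq)
next
  case (Suc K)
  show ?case
    unfolding sound_def excluded_def
  proof (intro allI impI notI)
    fix R b L n s D ps r
    assume srch: "search (Suc K) R b L n s D ps" and st: "state n s D" and def: "s < 2 * n"
      and ps: "prime_list L ps" and r: "0 < r" "coprime n r" "\<forall>p\<in>prime_factors r. L \<le> p"
      "card (prime_factors r) \<le> Suc K" "bigomega r \<le> R"
      "b \<or> card (prime_factors r) < bigomega r" and pw: "primitive_weird (n * r)"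
    note n = stateD(1,2)[OF st]
    have "r \<noteq> 1" using primitive_weirdD(3)[OF pw] def n(2) by auto
    hence ne: "prime_factors r \<noteq> {}" using r(1) by (simp add: prime_factorization_empty_iff)
    define q where "q = Min (prime_factors r)"
    have q: "q \<in> prime_factors r" unfolding q_def using ne by (intro Min_in) auto
    hence q': "prime q" "L \<le> q" using r(3) by auto
    have qn: "\<not> q dvd n" using q r(2) by (meson coprime_common_divisor in_prime_factors_iff not_prime_unit)
    obtain e r' where r': "r = q ^ e * r'" "0 < e" "0 < r'" "\<not> q dvd r'" "coprime q r'"
      "prime_factors r' = prime_factors r - {q}" "bigomega r = e + bigomega r'"
      by (rule prime_power_cofactor[OF r(1) q])
    have card: "card (prime_factors r) = Suc (card (prime_factors r'))"
      unfolding r'(6) by (rule card.remove[OF finite_set_mset q])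
    have "R \<noteq> 0" "b \<or> R \<noteq> 1" using r'(2,7) r(5,6) card by auto
    hence last: "last_power R L n s (2 * n - s) D" "b \<longrightarrow> last_prime L n s (2 * n - s) D"
      and rest: "K \<noteq> 0 \<longrightarrow> least_prime (search K) (Suc K) R b n s D (dropWhile (\<lambda>p. p < L) ps)"
      using srch by (auto simp: last_check_def split: if_splits)
    show False
    proof (cases "r' = 1")
      case True
      show False
      proof (cases "e = 1")
        case e: True
        hence b using r(6) card True r'(7) by (simp add: bigomega_def)
        thus False
          using last_prime_sound[OF _ st def refl q'(1) qn q'(2)] last(2) pw r'(1) True e by simp
      next
        case False
        thus False
          using last_power_sound[OF last(1) st def refl q'(1) qn q'(2), of e] pw r' r(5) True by simp
      qed
    next
      case False
      have gt: "\<forall>p\<in>prime_factors r'. q < p"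
      proof
        fix p assume p: "p \<in> prime_factors r'"
        hence "q \<le> p" unfolding q_def using r'(6) by (intro Min_le) auto
        thus "q < p" using p r'(6) by (cases "p = q") auto
      qed
      have "prime_factors r' \<noteq> {}" using False r'(3) by (simp add: prime_factorization_empty_iff)
      hence "card (prime_factors r') \<noteq> 0" by simp
      hence "K \<noteq> 0" using card r(4) by linarith
      let ?ps = "dropWhile (\<lambda>p. p < L) ps"
      have lp: "least_prime (search K) (Suc K) R b n s D ?ps" using rest \<open>K \<noteq> 0\<close> by simp
      have pl: "prime_list L ?ps" using ps by (rule prime_list_dropWhile)
      hence "sorted_wrt (<) ?ps" "q \<in> set ?ps \<or> (\<forall>x\<in>set ?ps. x < q)"
        using q' by (auto simp: prime_list_def)
      with lp show False
      proof (cases rule: least_prime_cases)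
        case (1 p)
        have p1: "1 < p" using 1(1) pl by (auto simp: prime_list_def)
        \<comment> \<open>The estimate is used with the entry \<open>p\<close> at which the run
          stopped; every prime factor of \<open>r\<close> is at least \<open>p\<close>.\<close>
        have "sigma (n * r) * (p - 1) ^ Suc K \<le> sigma n * r * p ^ Suc K"
        proof (rule sigma_mult_le)
          show "\<forall>x\<in>prime_factors r. p \<le> x"
            using 1(2) Min_le[of "prime_factors r"] unfolding q_def by (meson finite_set_mset order_trans)
        qed (use r n p1 in auto)
        also have "\<dots> = r * (s * p ^ Suc K)" unfolding n(2) by (simp only: mult_ac)
        also have "\<dots> \<le> r * (2 * n * (p - 1) ^ Suc K)" using 1(3) by (rule mult_le_mono2)
        also have "\<dots> = 2 * (n * r) * (p - 1) ^ Suc K" by (simp only: mult_ac)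
        finally have "(p - 1) ^ Suc K = 0 \<or> sigma (n * r) \<le> 2 * (n * r)"
          by (simp only: mult_le_cancel2) blast
        hence "sigma (n * r) \<le> 2 * (n * r)" using p1 by (simp del: power_Suc)
        thus False using primitive_weirdD(3)[OF pw] by simp
      next
        case (2 us qs)
        show False
        proof (rule exponents_sound[OF 2(2) Suc.IH st, of 0])
          show "prime_list (q + 1) qs" using pl q'(2) unfolding 2(1) by (rule prime_list_suffix)
          show "primitive_weird (n * (q ^ e * r'))" using pw r'(1) by simp
          show "coprime (n * q) r'" using r(2) r'(1,5) by simp
          show "card (prime_factors r') \<le> K" using card r(4) by simp
          show "e + bigomega r' \<le> R + 0" using r(5) r'(7) by simp
          show "b \<or> Suc 0 < e \<or> card (prime_factors r') < bigomega r'"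
            using r(6) card r'(2,7) by linarith
        qed (use st def q' qn r' gt False in auto)
      qed
    qed
  qed
qed

section \<open>Evaluation\<close>

text \<open>The odd primes below 360, enough for the estimate in \<open>least_prime\<close> to
  succeed before the list ends in all five runs below.\<close>

definition small_primes :: "nat list" where
  "small_primes = [3, 5, 7, 11, 13, 17, 19, 23, 29, 31, 37, 41, 43, 47, 53, 59, 61, 67, 71, 73, 79, 83, 89, 97,
    101, 103, 107, 109, 113, 127, 131, 137, 139, 149, 151, 157, 163, 167, 173, 179, 181, 191, 193,
    197, 199, 211, 223, 227, 229, 233, 239, 241, 251, 257, 263, 269, 271, 277, 281, 283, 293, 307,
    311, 313, 317, 331, 337, 347, 349, 353, 359]"

lemma prime_list_filter: "1 < L \<Longrightarrow> prime_list L (filter (\<lambda>p. \<not> composite p) [L..<H])"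
  by (auto simp: prime_list_def sorted_wrt_filter prime_not_composite)

lemma prime_list_small_primes: "prime_list 3 small_primes"
proof -
  have *: "small_primes = filter (\<lambda>p. \<not> composite p) [3..<360]" by code_simp
  show ?thesis unfolding * by (rule prime_list_filter) simp
qed

text \<open>The runs start from \<open>n = 2 ^ a\<close> for \<open>a\<close> from 0 to 4, with at
  most \<open>5 - a\<close> odd primes, counted \<open>7 - a\<close> times at most, and no
  repetition so far.\<close>

lemma search_odd: "search 5 7 False 3 1 1 [1] small_primes"
  by code_simp

lemma search_2: "search 4 6 False 3 2 3 [1, 2] small_primes"
  by code_simp

lemma search_4: "search 3 5 False 3 4 7 [1, 2, 4] small_primes"
  by code_simp

lemma search_8: "search 2 4 False 3 8 15 [1, 2, 4, 8] small_primes"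
  by code_simp

lemma search_16: "search 1 3 False 3 16 31 [1, 2, 4, 8, 16] small_primes"
  by code_simp

lemma state_powers_of_2:
  "state 1 1 [1]" "state 2 3 [1, 2]" "state 4 7 [1, 2, 4]" "state 8 15 [1, 2, 4, 8]"
  "state 16 31 [1, 2, 4, 8, 16]"
proof -
  have step: "state (2 * n) (1 + 2 * s) (extend 2 [1] D)" if "state n s D" "n = 2 ^ a" for n s D a
    using state_extend[of 1 1 "[1]" 2 a s D] that by (simp add: state_def sigma_def)
  show 0: "state 1 1 [1]" by (simp add: state_def sigma_def)
  show 1: "state 2 3 [1, 2]" using step[OF 0, of 0] by (simp add: extend_def numeral_eq_Suc)
  show 2: "state 4 7 [1, 2, 4]" using step[OF 1, of 1] by (simp add: extend_def)
  show 3: "state 8 15 [1, 2, 4, 8]" using step[OF 2, of 2] by (simp add: extend_def)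
  show "state 16 31 [1, 2, 4, 8, 16]" using step[OF 3, of 3] by (simp add: extend_def)
qed

lemma excluded_powers_of_2:
  assumes "a \<le> 4"
  shows "excluded (5 - a) (7 - a) False 3 (2 ^ a)"
proof -
  note * = search_sound[unfolded sound_def, rule_format, OF _ _ _ prime_list_small_primes]
  consider "a = 0" | "a = 1" | "a = 2" | "a = 3" | "a = 4" using assms by linarith
  thus ?thesis
  proof cases
    case 1
    thus ?thesis using *[OF search_odd state_powers_of_2(1)] by simp
  next
    case 2
    thus ?thesis using *[OF search_2 state_powers_of_2(2)] by simp
  next
    case 3
    thus ?thesis using *[OF search_4 state_powers_of_2(3)] by simp
  next
    case 4
    thus ?thesis using *[OF search_8 state_powers_of_2(4)] by simp
  next
    case 5
    thus ?thesis using *[OF search_16 state_powers_of_2(5)] by simp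
  qed
qed

section \<open>Repeated odd primes and the conclusion\<close>

lemma card_prime_factors_le_bigomega: "card (prime_factors r) \<le> bigomega r"
  unfolding bigomega_def using size_mset_mono[OF mset_set_set_mset_msubset[of "prime_factorization r"]] by simp

lemma odd_part_squarefree:
  assumes "primitive_weird (2 ^ a * r)" "odd r" "bigomega r \<le> 7 - a" "a + card (prime_factors r) \<le> 5"
  shows "bigomega r = card (prime_factors r)"
proof (rule ccontr)
  assume "bigomega r \<noteq> card (prime_factors r)"
  hence less: "card (prime_factors r) < bigomega r"
    using card_prime_factors_le_bigomega[of r] by simp
  have "0 < r" using primitive_weirdD(2)[OF assms(1)] by (auto intro: gr0I)
  moreover have "r \<noteq> 1" using less by (auto simp: bigomega_def)
  ultimately have "card (prime_factors r) \<noteq> 0" by (simp add: prime_factorization_empty_iff)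
  \<comment> \<open>If \<open>r\<close> is not squarefree it has a prime factor, so the five runs
    cover every exponent of 2.\<close>
  hence "a \<le> 4" using assms(4) by linarith
  hence "excluded (5 - a) (7 - a) False 3 (2 ^ a)" by (rule excluded_powers_of_2)
  moreover have "coprime (2 ^ a) r" using assms(2) by simp
  moreover have "\<forall>p\<in>prime_factors r. 3 \<le> p"
  proof
    fix p assume "p \<in> prime_factors r"
    hence "prime p" "p dvd r" by auto
    moreover from this(2) have "odd p" using assms(2) dvd_trans by blast
    ultimately show "3 \<le> p" using prime_ge_2_nat[of p] by (cases "p = 2") auto
  qed
  moreover have "card (prime_factors r) \<le> 5 - a" using assms(4) by simp
  ultimately show False using assms(1,3) less \<open>0 < r\<close> unfolding excluded_def by blast
qed

text \<open>The multiset \<open>M\<close> lists forced repetitions: the factorization contains every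
  prime factor once and, on top of that, all of \<open>M\<close>.\<close>

lemma bigomega_ge:
  assumes "r \<noteq> 0" "\<And>q. q \<in># M \<Longrightarrow> prime q \<and> q ^ Suc (count M q) dvd r"
  shows "card (prime_factors r) + size M \<le> bigomega r"
proof -
  have "mset_set (prime_factors r) + M \<subseteq># prime_factorization r"
  proof (rule mset_subset_eqI)
    fix q
    show "count (mset_set (prime_factors r) + M) q \<le> count (prime_factorization r) q"
    proof (cases "q \<in># M")
      case True
      hence q: "prime q" "q ^ Suc (count M q) dvd r" using assms(2) by auto
      hence "Suc (count M q) \<le> multiplicity q r"
        using assms(1) by (intro multiplicity_geI) auto
      thus ?thesis using q(1) by (simp add: count_prime_factorization_prime count_mset_set')
    next
      case False
      thus ?thesis by (simp add: count_mset_set' not_in_iff Suc_le_eq)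
    qed
  qed
  thus ?thesis unfolding bigomega_def using size_mset_mono by fastforce
qed

theorem theorem4p7:
  fixes m :: nat
  assumes "primitive_weird m"
  shows "(bigomega m < 7 \<longrightarrow> \<not> (\<exists>q. prime q \<and> odd q \<and> q ^ 2 dvd m)) \<and>
    (bigomega m = 7 \<longrightarrow>
      \<not> (\<exists>q1 q2. prime q1 \<and> odd q1 \<and> prime q2 \<and> odd q2 \<and> q1 \<noteq> q2 \<and>
             exactly_divides q1 2 m \<and> exactly_divides q2 2 m)) \<and>
    (bigomega m = 7 \<longrightarrow> \<not> (\<exists>q. prime q \<and> odd q \<and> q ^ 3 dvd m))"
proof -
  have m0: "m \<noteq> 0" using primitive_weirdD(2)[OF assms] by simp
  define a where "a = multiplicity 2 m"
  obtain r where m: "m = 2 ^ a * r" and r: "odd r"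
    using multiplicity_decompose'[of m 2] m0 unfolding a_def by auto
  have r0: "r \<noteq> 0" using r by (auto intro: odd_pos)
  have om: "bigomega m = a + bigomega r"
    using r0 unfolding m bigomega_def
    by (simp add: prime_factorization_mult prime_factorization_prime_power)
  \<comment> \<open>The \<open>size M\<close> repetitions and
    \<open>bigomega m \<le> size M + 5\<close> leave at most 5 for \<open>a\<close> plus the number
    of distinct odd primes. Hence \<open>r\<close> is squarefree and \<open>M\<close> is empty. The
    three claims take for \<open>M\<close> one prime, two distinct primes, and one prime
    twice.\<close>
  have few: "size M \<le> 0"
    if "\<And>q. q \<in># M \<Longrightarrow> prime q \<and> odd q \<and> q ^ Suc (count M q) dvd m"
      "bigomega m \<le> 7" "bigomega m \<le> size M + 5" for M
  proof -
    have "prime q \<and> q ^ Suc (count M q) dvd r" if "q \<in># M" for q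
    proof -
      have q: "prime q" "odd q" "q ^ Suc (count M q) dvd 2 ^ a * r"
        using \<open>q \<in># M\<close> \<open>\<And>q. q \<in># M \<Longrightarrow> _ q\<close> by (auto simp: m)
      have "coprime (q ^ Suc (count M q)) (2 ^ a)" using q(2) by simp
      thus ?thesis using q coprime_dvd_mult_right_iff by blast
    qed
    hence ge: "card (prime_factors r) + size M \<le> bigomega r" by (rule bigomega_ge[OF r0])
    have "bigomega r = card (prime_factors r)"
      by (rule odd_part_squarefree[of a]) (use assms m r om ge that(2,3) in auto)
    thus ?thesis using ge by simp
  qed
  show ?thesis
  proof (intro conjI impI notI; (elim exE conjE)?)
    fix q assume "bigomega m < 7" "prime q" "odd q" "q ^ 2 dvd m"
    thus False using few[of "{#q#}"] by (simp add: power2_eq_square)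
  next
    fix q1 q2 assume *: "bigomega m = 7" "prime q1" "odd q1" "prime q2" "odd q2" "q1 \<noteq> q2"
      "exactly_divides q1 2 m" "exactly_divides q2 2 m"
    hence "prime q \<and> odd q \<and> q ^ Suc (count {#q1, q2#} q) dvd m" if "q \<in># {#q1, q2#}" for q
      using that by (auto simp: exactly_divides_def power2_eq_square)
    thus False using few[of "{#q1, q2#}"] *(1) by simp
  next
    fix q assume "bigomega m = 7" "prime q" "odd q" "q ^ 3 dvd m"
    thus False using few[of "{#q, q#}"] by (simp add: power3_eq_cube mult.assoc)
  qed
qed

end
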